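(* Let $(G,\omega,\mu)$ be a connected, locally finite weighted graph, let $d$ be a distance on $G$, let $V:G\to\mathbb{R}$ with $V\ge 0$, let $x_0\in G$ and let $f:G\to\mathbb{R}$. Suppose that there exists a function $Z:G\to\mathbb{R}$, bounded from above, such that $$\Delta Z(x)\ge -V(x)\quad\text{for all }x\in G,\qquad \lim_{d(x,x_0)\to+\infty}Z(x)=-\infty .$$ Then there exists at most one solution $u:G\to\mathbb{R}$ of $\Delta u-Vu=f$ in $G$ such that $$\lim_{d(x,x_0)\to+\infty}\frac{u(x)}{Z(x)}=0 .$$
   Context: A weighted graph is a triplet $(G,\omega,\mu)$ where $G$ is a countably infinite set, $\mu:G\to(0,+\infty)$ is the node measure, and $\omega:G\times G\to[0,+\infty)$ is the edge weight, satisfying $\omega(x,y)=\omega(y,x)$, $\omega(x,x)=0$ and $\sum_{y\in G}\omega(x,y)<\infty$ for all $x,y\in G$. Write $x\sim y$ if $\omega(x,y)>0$. A path is a finite sequence of vertices $x_0,\dots,x_n$ with $x_k\sim x_{k+1}$ for all $k=0,\dots,n-1$. The graph is connected if any two distinct vertices are joined by a path, and locally finite if every $x\in G$ has only finitely many $y\in G$ with $x\sim y$. The distance $d:G\times G\to[0,+\infty)$ is an arbitrary distance on $G$. The Laplace operator is $\Delta f(x)=\frac1{\mu(x)}\sum_{y\in G}[f(y)-f(x)]\,\omega(x,y)$ for $f:G\to\mathbb{R}$, $x\in G$. A function $u:G\to\mathbb{R}$ is a solution of $\Delta u-Vu=f$ in $G$ if $\Delta u(x)-V(x)u(x)=f(x)$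 for every $x\in G$.
   Formalization: It is additionally assumed that every ball of the distance d is finite; for an arbitrary distance the claim is false, for instance for a bounded d with V = f = Z = 0, where all constants are solutions. *)

theory Defs
  imports "HOL-Analysis.Analysis" "HOL-Library.Going_To_Filter"
begin

text \<open>The vertex set is the universe of the type \<open>'a\<close>.\<close>

locale weighted_graph =
  fixes \<omega> :: "'a \<Rightarrow> 'a \<Rightarrow> real" and \<mu> :: "'a \<Rightarrow> real"
  assumes countable_vertices: "countable (UNIV :: 'a set)"
    and infinite_vertices: "infinite (UNIV :: 'a set)"
    and measure_pos: "\<mu> x > 0"
    and weight_nonneg: "\<omega> x y \<ge> 0"
    and weight_sym: "\<omega> x y = \<omega> y x"
    and weight_diag: "\<omega> x x = 0"
    and weight_summable: "\<omega> x summable_on UNIV"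

definition adjacent :: "('a \<Rightarrow> 'a \<Rightarrow> real) \<Rightarrow> 'a \<Rightarrow> 'a \<Rightarrow> bool" where
  "adjacent \<omega> x y \<longleftrightarrow> \<omega> x y > 0"

definition graph_path :: "('a \<Rightarrow> 'a \<Rightarrow> real) \<Rightarrow> 'a list \<Rightarrow> bool" where
  "graph_path \<omega> xs \<longleftrightarrow> xs \<noteq> [] \<and> successively (adjacent \<omega>) xs"

definition connected_graph :: "('a \<Rightarrow> 'a \<Rightarrow> real) \<Rightarrow> bool" where
  "connected_graph \<omega> \<longleftrightarrow>
     (\<forall>x y. x \<noteq> y \<longrightarrow> (\<exists>xs. graph_path \<omega> xs \<and> hd xs = x \<and> last xs = y))"

definition locally_finite_graph :: "('a \<Rightarrow> 'a \<Rightarrow> real) \<Rightarrow> bool" where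
  "locally_finite_graph \<omega> \<longleftrightarrow> (\<forall>x. finite {y. adjacent \<omega> x y})"

text \<open>On a locally finite graph the sum has only finitely many nonzero terms, so the convention
  that \<^const>\<open>infsum\<close> is 0 on families that are not summable plays no role there.\<close>

definition laplacian ::
  "('a \<Rightarrow> 'a \<Rightarrow> real) \<Rightarrow> ('a \<Rightarrow> real) \<Rightarrow> ('a \<Rightarrow> real) \<Rightarrow> 'a \<Rightarrow> real" where
  "laplacian \<omega> \<mu> f x = 1 / \<mu> x * (\<Sum>\<^sub>\<infinity>y\<in>UNIV. (f y - f x) * \<omega> x y)"

definition is_solution ::
  "('a \<Rightarrow> 'a \<Rightarrow> real) \<Rightarrow> ('a \<Rightarrow> real) \<Rightarrow> ('a \<Rightarrow> real) \<Rightarrow> ('a \<Rightarrow> real) \<Rightarrow> ('a \<Rightarrow> real) \<Rightarrow> bool" where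
  "is_solution \<omega> \<mu> V f u \<longleftrightarrow> (\<forall>x. laplacian \<omega> \<mu> u x - V x * u x = f x)"

text \<open>The balls of an arbitrary distance need not be finite, and \<open>d(x, x\<^sub>0) \<rightarrow> \<infinity>\<close> constrains a function
  outside large balls only. Without finiteness, uniqueness fails: on \<open>\<int>\<close> with unit weights on
  nearest neighbours, \<open>\<mu> = V = 1\<close>, \<open>f = 0\<close> and \<open>Z(n) = - max n 0\<close>, take
  \<open>d(m, n) = \<bar>\<phi>(m) - \<phi>(n)\<bar>\<close> with \<open>\<phi>(n) = n\<close> for \<open>n \<ge> 0\<close> and \<open>\<phi>(n) = n / (1 - n)\<close>
  for \<open>n < 0\<close>. Then \<open>0\<close> and \<open>r\<^sup>n\<close> with \<open>r + 1/r = 3\<close>, \<open>0 < r < 1\<close>, are both solutions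
  that are \<open>o(Z)\<close>.\<close>

definition finite_balls :: "('a \<Rightarrow> 'a \<Rightarrow> real) \<Rightarrow> bool" where
  "finite_balls d \<longleftrightarrow> (\<forall>x r. finite (Metric_space.mball UNIV d x r))"

end

theory Submission
  imports Defs
begin

text \<open>
  The difference \<open>w\<close> of two solutions satisfies \<open>\<Delta> w = V w\<close>. If \<open>Z \<le> K\<close> with \<open>K \<ge> 0\<close>, then
  \<open>h = K + 1 - Z\<close> satisfies \<open>h \<ge> 1\<close> and hence
  \<open>\<Delta> h = - \<Delta> Z \<le> V \<le> V h\<close>. Thus \<open>h\<close> is a positive supersolution that dominates \<open>\<bar>Z\<bar>\<close> near infinity,
  so \<open>\<bar>w\<bar> = o(h)\<close>, and for every \<open>\<epsilon> > 0\<close> the supersolution \<open>\<epsilon> h - w\<close> is negative on a finite set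
  at most. The minimum principle (\<open>supersolution_nonneg\<close>) forces \<open>w \<le> \<epsilon> h\<close> on the whole graph;
  letting \<open>\<epsilon> \<rightarrow> 0\<close> gives \<open>w \<le> 0\<close> (\<open>small_solution_nonpos\<close>), and the same argument
  applies to \<open>- w\<close>.

  The minimum principle is where connectedness enters. A negative minimum of a supersolution
  is shared by all the neighbours of the point where it is attained, hence by the whole graph; but the
  graph is infinite, whereas the function is negative at finitely many points only. Finiteness of
  balls is what turns a statement about \<open>d x x\<^sub>0 \<rightarrow> \<infinity>\<close> into one about the
  complement of a finite set.
\<close>

lemma laplacian_eq_sum:
  assumes "weighted_graph \<omega> \<mu>" and "locally_finite_graph \<omega>"
  shows "laplacian \<omega> \<mu> f x = 1 / \<mu> x * (\<Sum>y\<in>{y. adjacent \<omega> x y}. (f y - f x) * \<omega> x y)"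
proof -
  interpret weighted_graph \<omega> \<mu> by fact
  have "\<omega> x y = 0" if "\<not> adjacent \<omega> x y" for y
    using that weight_nonneg[of x y] by (simp add: adjacent_def)
  then have "(\<Sum>\<^sub>\<infinity>y\<in>UNIV. (f y - f x) * \<omega> x y) = (\<Sum>\<^sub>\<infinity>y\<in>{y. adjacent \<omega> x y}. (f y - f x) * \<omega> x y)"
    by (intro infsum_cong_neutral) auto
  then show ?thesis
    using assms(2) by (simp add: laplacian_def locally_finite_graph_def)
qed

lemma laplacian_diff:
  assumes "weighted_graph \<omega> \<mu>" and "locally_finite_graph \<omega>"
  shows "laplacian \<omega> \<mu> (\<lambda>x. f x - g x) x = laplacian \<omega> \<mu> f x - laplacian \<omega> \<mu> g x"
  unfolding laplacian_eq_sum[OF assms] right_diff_distrib[symmetric] sum_subtractf[symmetric]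
  by (simp add: algebra_simps)

lemma laplacian_cmult:
  assumes "weighted_graph \<omega> \<mu>" and "locally_finite_graph \<omega>"
  shows "laplacian \<omega> \<mu> (\<lambda>x. c * f x) x = c * laplacian \<omega> \<mu> f x"
  unfolding laplacian_eq_sum[OF assms] by (simp add: sum_distrib_left algebra_simps)

lemma laplacian_const:
  assumes "weighted_graph \<omega> \<mu>" and "locally_finite_graph \<omega>"
  shows "laplacian \<omega> \<mu> (\<lambda>x. c) x = 0"
  unfolding laplacian_eq_sum[OF assms] by simp

lemma connected_graph_closed_subset_eq_UNIV:
  assumes "connected_graph \<omega>" and "a \<in> S"
    and closed: "\<And>x y. x \<in> S \<Longrightarrow> adjacent \<omega> x y \<Longrightarrow> y \<in> S"
  shows "S = UNIV"
proof -
  have path: "last xs \<in> S" if "xs \<noteq> []" "successively (adjacent \<omega>) xs" "hd xs \<in> S" for xs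
    using that
  proof (induction xs rule: induct_list012)
    case (3 x y zs)
    then show ?case using closed by auto
  qed auto
  have "b \<in> S" for b
  proof (cases "a = b")
    case False
    then obtain xs where "graph_path \<omega> xs" "hd xs = a" "last xs = b"
      using assms(1) unfolding connected_graph_def by blast
    then show ?thesis using path[of xs] assms(2) by (auto simp: graph_path_def)
  qed (use assms(2) in simp)
  then show ?thesis by auto
qed

text \<open>At a point where \<open>g\<close> is minimal, the sum defining \<open>\<Delta> g\<close> has nonnegative terms; it can be
  nonpositive only if all of them vanish.\<close>

lemma neighbour_eq_minimum:
  assumes "weighted_graph \<omega> \<mu>" and "locally_finite_graph \<omega>"
    and min: "\<And>y. g x \<le> g y" and lap: "laplacian \<omega> \<mu> g x \<le> 0" and adj: "adjacent \<omega> x y"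
  shows "g y = g x"
proof -
  interpret weighted_graph \<omega> \<mu> by fact
  let ?N = "{y. adjacent \<omega> x y}"
  have fin: "finite ?N" using assms(2) by (simp add: locally_finite_graph_def)
  have nonneg: "(g y - g x) * \<omega> x y \<ge> 0" for y
    using min[of y] weight_nonneg[of x y] by simp
  have "(\<Sum>y\<in>?N. (g y - g x) * \<omega> x y) \<le> 0"
    using lap measure_pos[of x]
    unfolding laplacian_eq_sum[OF assms(1,2)] by (simp add: divide_le_0_iff)
  then have "(\<Sum>y\<in>?N. (g y - g x) * \<omega> x y) = 0"
    using sum_nonneg[of ?N "\<lambda>y. (g y - g x) * \<omega> x y"] nonneg by (simp add: order_antisym)
  then have "(g y - g x) * \<omega> x y = 0"
    using sum_nonneg_eq_0_iff[OF fin, of "\<lambda>y. (g y - g x) * \<omega> x y"] nonneg adj by simp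
  then show ?thesis using adj by (simp add: adjacent_def)
qed

text \<open>The minimum principle. At a negative minimum the right-hand side \<open>V g\<close> is nonpositive, so the
  minimum spreads to the neighbours and then to the whole infinite graph.\<close>

lemma supersolution_nonneg:
  assumes graph: "weighted_graph \<omega> \<mu>" and locfin: "locally_finite_graph \<omega>"
    and conn: "connected_graph \<omega>" and V: "\<And>x. V x \<ge> 0"
    and super: "\<And>x. laplacian \<omega> \<mu> g x \<le> V x * g x"
    and fin: "finite {x. g x < 0}"
  shows "g x \<ge> 0"
proof (rule ccontr)
  interpret weighted_graph \<omega> \<mu> by fact
  let ?N = "{x. g x < 0}"
  assume "\<not> g x \<ge> 0"
  then have "?N \<noteq> {}" by (auto simp: not_le)
  then obtain a where a: "a \<in> ?N" and a_min: "\<And>y. y \<in> ?N \<Longrightarrow> g a \<le> g y"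
    using ex_is_arg_min_if_finite[OF fin, of g] by (auto simp: is_arg_min_linorder)
  have min: "g a \<le> g y" for y
    using a a_min[of y] by (cases "y \<in> ?N") auto
  have "{x. g x = g a} = UNIV"
  proof (rule connected_graph_closed_subset_eq_UNIV[OF conn])
    fix x y assume x: "x \<in> {x. g x = g a}" and "adjacent \<omega> x y"
    have "V x * g x \<le> 0" using x a V[of x] by (simp add: mult_nonneg_nonpos)
    then have "laplacian \<omega> \<mu> g x \<le> 0" using super[of x] by linarith
    then show "y \<in> {x. g x = g a}"
      using neighbour_eq_minimum[OF graph locfin, of g x y] min x \<open>adjacent \<omega> x y\<close> by simp
  qed auto
  moreover have "{x. g x = g a} \<subseteq> ?N" using a by auto
  ultimately have "?N = UNIV" by blast
  then show False using fin infinite_vertices by simp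
qed

text \<open>Each \<open>\<epsilon> h - w\<close> is a supersolution with finitely many negative values, so \<open>w \<le> \<epsilon> h\<close> everywhere,
  and the bound at a fixed vertex survives \<open>\<epsilon> \<rightarrow> 0\<close>.\<close>

lemma small_solution_nonpos:
  assumes graph: "weighted_graph \<omega> \<mu>" and locfin: "locally_finite_graph \<omega>"
    and conn: "connected_graph \<omega>" and V: "\<And>x. V x \<ge> 0"
    and w: "\<And>x. laplacian \<omega> \<mu> w x = V x * w x"
    and h: "\<And>x. laplacian \<omega> \<mu> h x \<le> V x * h x"
    and small: "\<And>\<epsilon>. \<epsilon> > 0 \<Longrightarrow> finite {x. \<epsilon> * h x < w x}"
  shows "w x \<le> 0"
proof -
  have bound: "w x \<le> \<epsilon> * h x" if \<epsilon>: "\<epsilon> > 0" for \<epsilon>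
  proof -
    have "\<epsilon> * h x - w x \<ge> 0"
    proof (rule supersolution_nonneg[OF graph locfin conn V, of "\<lambda>x. \<epsilon> * h x - w x"])
      fix x
      show "laplacian \<omega> \<mu> (\<lambda>x. \<epsilon> * h x - w x) x \<le> V x * (\<epsilon> * h x - w x)"
        using mult_left_mono[OF h[of x], of \<epsilon>] \<epsilon> w[of x]
        by (simp add: laplacian_diff[OF graph locfin] laplacian_cmult[OF graph locfin] algebra_simps)
    qed (use small[OF \<epsilon>] in simp)
    then show ?thesis by simp
  qed
  have "((\<lambda>\<epsilon>. \<epsilon> * h x) \<longlongrightarrow> 0 * h x) (at_right 0)"
    by (intro tendsto_intros)
  then show ?thesis
    using tendsto_lowerbound[of "\<lambda>\<epsilon>. \<epsilon> * h x" "0 * h x" "at_right 0" "w x"]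
      eventually_at_right_less[of "0 :: real"] bound
    by (simp add: eventually_mono)
qed

lemma finite_exceptions_if_eventually_far:
  assumes "Metric_space UNIV d" and "finite_balls d"
    and ev: "eventually P ((\<lambda>x. d x x\<^sub>0) going_to at_top)"
  shows "finite {x. \<not> P x}"
proof -
  interpret Metric_space UNIV d by fact
  obtain R where R: "\<And>x. d x x\<^sub>0 \<ge> R \<Longrightarrow> P x"
    using ev by (auto simp: eventually_going_to_at_top_linorder)
  have "{x. \<not> P x} \<subseteq> mball x\<^sub>0 R"
    using R by (auto simp: in_mball commute not_le[symmetric])
  then show ?thesis
    using assms(2) finite_subset unfolding finite_balls_def by blast
qed

theorem corollary3p4:
  fixes \<omega> :: "'a \<Rightarrow> 'a \<Rightarrow> real" and \<mu> :: "'a \<Rightarrow> real"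
    and d :: "'a \<Rightarrow> 'a \<Rightarrow> real" and V f Z :: "'a \<Rightarrow> real" and x\<^sub>0 :: 'a
  assumes graph: "weighted_graph \<omega> \<mu>"
    and conn: "connected_graph \<omega>"
    and locfin: "locally_finite_graph \<omega>"
    and dist: "Metric_space UNIV d"
    and balls: "finite_balls d"
    and V_nonneg: "\<forall>x. V x \<ge> 0"
    and Z_bdd: "bdd_above (range Z)"
    and Z_lap: "\<forall>x. laplacian \<omega> \<mu> Z x \<ge> - V x"
    and Z_lim: "filterlim Z at_bot ((\<lambda>x. d x x\<^sub>0) going_to at_top)"
  shows "\<exists>\<^sub>\<le>\<^sub>1 u :: 'a \<Rightarrow> real. is_solution \<omega> \<mu> V f u \<and>
           ((\<lambda>x. u x / Z x) \<longlongrightarrow> 0) ((\<lambda>x. d x x\<^sub>0) going_to at_top)"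
proof (rule Uniq_I)
  let ?F = "(\<lambda>x. d x x\<^sub>0) going_to at_top"
  obtain K\<^sub>0 where K\<^sub>0: "\<And>x. Z x \<le> K\<^sub>0"
    using Z_bdd by (auto simp: bdd_above_def)
  \<comment> \<open>A nonnegative bound makes \<open>h\<close> dominate \<open>\<bar>Z\<bar>\<close> wherever \<open>Z\<close> is negative.\<close>
  define K where "K = max K\<^sub>0 0"
  have K: "Z x \<le> K" for x
    using K\<^sub>0[of x] by (simp add: K_def)
  have "K \<ge> 0" by (simp add: K_def)
  define h where "h x = (K + 1) - Z x" for x
  have V: "V x \<ge> 0" for x using V_nonneg by simp
  have h: "laplacian \<omega> \<mu> h x \<le> V x * h x" for x
  proof -
    have "laplacian \<omega> \<mu> h x = - laplacian \<omega> \<mu> Z x"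
      unfolding h_def laplacian_diff[OF graph locfin] laplacian_const[OF graph locfin] by simp
    also have "\<dots> \<le> V x * 1" using Z_lap[rule_format, of x] by simp
    also have "\<dots> \<le> V x * h x" using K[of x] V[of x] by (intro mult_left_mono) (auto simp: h_def)
    finally show ?thesis .
  qed
  have diff_nonpos: "u x - v x \<le> 0"
    if u: "is_solution \<omega> \<mu> V f u" "((\<lambda>x. u x / Z x) \<longlongrightarrow> 0) ?F"
      and v: "is_solution \<omega> \<mu> V f v" "((\<lambda>x. v x / Z x) \<longlongrightarrow> 0) ?F" for u v x
  proof (rule small_solution_nonpos[OF graph locfin conn V _ h, of "\<lambda>x. u x - v x"])
    fix x
    show "laplacian \<omega> \<mu> (\<lambda>x. u x - v x) x = V x * (u x - v x)"
      using u(1) v(1) unfolding is_solution_def laplacian_diff[OF graph locfin]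
      by (simp add: algebra_simps)
  next
    fix \<epsilon> :: real assume \<epsilon>: "\<epsilon> > 0"
    have "((\<lambda>x. u x / Z x - v x / Z x) \<longlongrightarrow> 0) ?F"
      using tendsto_diff[OF u(2) v(2)] by simp
    then have "eventually (\<lambda>x. \<bar>(u x - v x) / Z x\<bar> < \<epsilon>) ?F"
      using \<epsilon> by (auto simp: tendsto_iff dist_real_def diff_divide_distrib)
    moreover have "eventually (\<lambda>x. Z x < 0) ?F"
      using Z_lim by (auto simp: filterlim_at_bot_dense)
    ultimately have "eventually (\<lambda>x. \<not> \<epsilon> * h x < u x - v x) ?F"
    proof eventually_elim
      case (elim x)
      then have "\<bar>u x - v x\<bar> / (- Z x) < \<epsilon>" by simp
      then have "u x - v x \<le> \<epsilon> * (- Z x)"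
        using elim pos_divide_less_eq[of "- Z x" "\<bar>u x - v x\<bar>" \<epsilon>] by linarith
      also have "\<dots> \<le> \<epsilon> * h x"
        using \<epsilon> \<open>K \<ge> 0\<close> by (intro mult_left_mono) (auto simp: h_def)
      finally show ?case by simp
    qed
    then show "finite {x. \<epsilon> * h x < u x - v x}"
      using finite_exceptions_if_eventually_far[OF dist balls] by fastforce
  qed
  fix u v
  assume "is_solution \<omega> \<mu> V f u \<and> ((\<lambda>x. u x / Z x) \<longlongrightarrow> 0) ?F"
    and "is_solution \<omega> \<mu> V f v \<and> ((\<lambda>x. v x / Z x) \<longlongrightarrow> 0) ?F"
  then have "u x - v x \<le> 0" "v x - u x \<le> 0" for x
    using diff_nonpos by blast+
  then show "u = v"
    by (intro ext order_antisym) auto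
qed

end
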